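(* Let $\delta_2,\ldots,\delta_{n+1}$ and $\epsilon_1,\ldots,\epsilon_{n+1}$ be independent mean-zero random variables bounded in absolute value by $u$, and $\gamma_k\equiv(1+u)^k-1$. Then for any $0<\delta<1$, with probability at least $1-\delta$, the error in shifted sequential summation of $x_1,\ldots,x_n$ with shift $c$ is bounded by $$|\hat{s}_n-s_n|\le\max_{1\le k\le n+1}\bigl(|t_k|+|y_k|\bigr)\sqrt{\frac{u\,\gamma_{2(n+2)}}{2}}\,\sqrt{2\ln(2/\delta)},$$ where $t_k=s_k-kc$ and $y_k=x_k-c$ for $1\le k\le n$, $t_{n+1}=s_n$ and $y_{n+1}=nc$. Moreover, if $2(n+2)u<1$, then $$\sqrt{\frac{u\,\gamma_{2(n+2)}}{2}}\le\sqrt{\frac{(n+2)u^2}{1-2(n+2)u}},$$ where the right-hand side is approximately $\sqrt{n+2}\,u$ for $n\ll 1/u$ (its ratio to $\sqrt{n+2}\,u$ tends to $1$ as $(n+2)u\to0$).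
   Context: Let $x_1,\ldots,x_n$ and $c$ be (deterministic) real numbers, $s_k=\sum_{j=1}^k x_j$, and let $0<u<1$ be the unit roundoff. Shifted sequential summation in exact arithmetic is: $y_k=x_k-c$ for $1\le k\le n$, $y_{n+1}=nc$, $t_1=y_1$, $t_k=t_{k-1}+y_k$ for $2\le k\le n+1$, with output $s_n=t_{n+1}=t_n+nc$. In floating point arithmetic, with centering errors $\epsilon_k$ and summation errors $\delta_k$ satisfying $|\epsilon_k|,|\delta_k|\le u$, $$\hat{t}_1=y_1(1+\epsilon_1)(1+\delta_1),\quad\delta_1=0,\qquad \hat{t}_k=\bigl(\hat{t}_{k-1}+y_k(1+\epsilon_k)\bigr)(1+\delta_k),\quad 2\le k\le n+1,$$ and the computed sum is $\hat{s}_n=\hat{t}_{n+1}$. *)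

theory Defs
  imports "HOL-Probability.Probability"
begin

text \<open>The summands of shifted summation; the last one, \<open>n c\<close>, undoes the shift.\<close>

definition shifted_summand :: "(nat \<Rightarrow> real) \<Rightarrow> real \<Rightarrow> nat \<Rightarrow> nat \<Rightarrow> real" where
  "shifted_summand x c n k = (if k \<le> n then x k - c else real n * c)"

text \<open>Indices start at \<open>1\<close>. In both recursions the value at \<open>0\<close> is an auxiliary \<open>0\<close>, so that
  \<open>t\<^sub>1 = y\<^sub>1\<close> exactly and \<open>t\<^sub>1 = y\<^sub>1 (1 + \<epsilon>\<^sub>1) (1 + \<delta>\<^sub>1)\<close> in floating point.\<close>

primrec shifted_partial_sum :: "(nat \<Rightarrow> real) \<Rightarrow> real \<Rightarrow> nat \<Rightarrow> nat \<Rightarrow> real" where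
  "shifted_partial_sum x c n 0 = 0"
| "shifted_partial_sum x c n (Suc k) =
     shifted_partial_sum x c n k + shifted_summand x c n (Suc k)"

primrec fl_shifted_partial_sum ::
    "(nat \<Rightarrow> real) \<Rightarrow> real \<Rightarrow> nat \<Rightarrow> (nat \<Rightarrow> real) \<Rightarrow> (nat \<Rightarrow> real) \<Rightarrow> nat \<Rightarrow> real" where
  "fl_shifted_partial_sum x c n \<epsilon> \<delta> 0 = 0"
| "fl_shifted_partial_sum x c n \<epsilon> \<delta> (Suc k) =
     (fl_shifted_partial_sum x c n \<epsilon> \<delta> k + shifted_summand x c n (Suc k) * (1 + \<epsilon> (Suc k)))
       * (1 + \<delta> (Suc k))"

definition fl_shifted_sum ::
    "(nat \<Rightarrow> real) \<Rightarrow> real \<Rightarrow> nat \<Rightarrow> (nat \<Rightarrow> real) \<Rightarrow> (nat \<Rightarrow> real) \<Rightarrow> real" where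
  "fl_shifted_sum x c n \<epsilon> \<delta> = fl_shifted_partial_sum x c n \<epsilon> \<delta> (n + 1)"

definition roundoff_gamma :: "real \<Rightarrow> nat \<Rightarrow> real" where
  "roundoff_gamma u k = (1 + u) ^ k - 1"

end

theory Submission
  imports Defs
begin

text \<open>
  Let \<open>e\<^sub>k\<close> be the error of the \<open>k\<close>-th computed partial sum. The two recursions give
  \<open>e\<^bsub>k+1\<^esub> = (e\<^sub>k + y\<^bsub>k+1\<^esub> \<epsilon>\<^bsub>k+1\<^esub>) (1 + \<delta>\<^bsub>k+1\<^esub>) + t\<^bsub>k+1\<^esub> \<delta>\<^bsub>k+1\<^esub>\<close>,
  where \<open>e\<^sub>k\<close> depends only on roundoffs with index at most \<open>k\<close>. Thus the error arises by
  bringing in one fresh roundoff \<open>Y\<close> at a time, each time replacing the current error \<open>X\<close>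
  by \<open>X (1 + b Y) + a Y\<close> with \<open>Y\<close> independent of \<open>X\<close>. The centering error enters with
  \<open>b = 0\<close>, \<open>a = y\<^bsub>k+1\<^esub>\<close>, and the summation error with \<open>b = 1\<close>, \<open>a = t\<^bsub>k+1\<^esub>\<close>.

  Call \<open>X\<close> sub-Gaussian with variance proxy \<open>V\<close> if its moment generating function at \<open>l\<close> is at
  most \<open>exp (l\<^sup>2 V / 2)\<close> for every real \<open>l\<close>. Once \<open>Y\<close> is fixed, the step above merely rescales
  and translates \<open>X\<close>, so Fubini and Hoeffding's lemma show that it keeps \<open>X\<close> sub-Gaussian, with
  proxy at most \<open>(1 + |b| u)\<^sup>2 V + (a u)\<^sup>2\<close> (lemma \<open>subgaussian_perturb\<close>). This plays the part of
  the Azuma--Hoeffding inequality, with independence turning conditioning on \<open>Y\<close> into integration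
  over a product measure.
  If \<open>B\<close> is the maximum of \<open>|t\<^sub>k| + |y\<^sub>k|\<close>, then \<open>t\<^sub>k\<^sup>2 + y\<^sub>k\<^sup>2 \<le> B\<^sup>2\<close>, and the proxies \<open>V\<^sub>k\<close> of
  \<open>e\<^sub>k\<close> satisfy \<open>V\<^bsub>k+1\<^esub> \<le> (1 + u)\<^sup>2 (V\<^sub>k + B\<^sup>2 u\<^sup>2)\<close>. They are therefore bounded by
  \<open>B\<^sup>2 u\<^sup>2\<close> times a geometric sum with ratio \<open>(1 + u)\<^sup>2\<close>
  (lemma \<open>fl_shifted_partial_sum_error_subgaussian\<close>). Since \<open>(1 + u)\<^sup>2 - 1 \<ge> 2 u\<close>, summing the
  series turns this into \<open>B\<^sup>2\<close> times the expression \<open>u \<gamma> / 2\<close> under the square root. A two-sided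
  Chernoff bound finishes the probabilistic part. The deterministic estimate of \<open>\<gamma>\<close> comes from
  Bernoulli's inequality applied to \<open>(1 - u)\<^sup>k\<close>.
\<close>

section \<open>Sub-Gaussian random variables\<close>

text \<open>The bound is required for \<open>l\<close> of either sign, which gives both tails and mean zero. The
  non-negative integral carries integrability of \<open>exp (l X)\<close> along with the bound.\<close>

definition subgaussian :: "'a measure \<Rightarrow> real \<Rightarrow> ('a \<Rightarrow> real) \<Rightarrow> bool" where
  "subgaussian M V X \<longleftrightarrow> X \<in> borel_measurable M \<and>
     (\<forall>l. (\<integral>\<^sup>+\<omega>. ennreal (exp (l * X \<omega>)) \<partial>M) \<le> ennreal (exp (l\<^sup>2 * V / 2)))"

lemma subgaussian_measurable: "subgaussian M V X \<Longrightarrow> X \<in> borel_measurable M"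
  by (simp add: subgaussian_def)

lemma subgaussian_nn_integral_le:
  "subgaussian M V X \<Longrightarrow>
    (\<integral>\<^sup>+\<omega>. ennreal (exp (l * X \<omega>)) \<partial>M) \<le> ennreal (exp (l\<^sup>2 * V / 2))"
  by (simp add: subgaussian_def)

lemma subgaussian_mono:
  assumes "subgaussian M V X" and "V \<le> W"
  shows "subgaussian M W X"
  unfolding subgaussian_def
proof (intro conjI allI)
  fix l :: real
  have "l\<^sup>2 * V / 2 \<le> l\<^sup>2 * W / 2"
    using assms(2) by (intro divide_right_mono mult_left_mono) auto
  then have "ennreal (exp (l\<^sup>2 * V / 2)) \<le> ennreal (exp (l\<^sup>2 * W / 2))"
    by (intro ennreal_leI) simp
  with subgaussian_nn_integral_le[OF assms(1)]
  show "(\<integral>\<^sup>+\<omega>. ennreal (exp (l * X \<omega>)) \<partial>M) \<le> ennreal (exp (l\<^sup>2 * W / 2))"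
    by (rule order_trans)
qed (rule subgaussian_measurable[OF assms(1)])

lemma subgaussian_uminus:
  assumes "subgaussian M V X"
  shows "subgaussian M V (\<lambda>\<omega>. - X \<omega>)"
  unfolding subgaussian_def
proof (intro conjI allI)
  fix l :: real
  show "(\<integral>\<^sup>+\<omega>. ennreal (exp (l * - X \<omega>)) \<partial>M) \<le> ennreal (exp (l\<^sup>2 * V / 2))"
    using subgaussian_nn_integral_le[OF assms, of "- l"] by simp
qed (use subgaussian_measurable[OF assms] in measurable)

context prob_space
begin

text \<open>Hoeffding's lemma covers positive \<open>l\<close>; negative \<open>l\<close> reduce to it by passing to \<open>- Y\<close>.\<close>

lemma bounded_centered_subgaussian:
  assumes [measurable]: "random_variable borel Y"
    and bnd: "AE \<omega> in M. \<bar>Y \<omega>\<bar> \<le> u" and mean: "expectation Y = 0"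
  shows "subgaussian M (u\<^sup>2) Y"
proof -
  have pos: "(\<integral>\<^sup>+\<omega>. ennreal (exp (l * Z \<omega>)) \<partial>M) \<le> ennreal (exp (l\<^sup>2 * u\<^sup>2 / 2))"
    if l: "l > 0" and [measurable]: "random_variable borel Z"
      and Z: "AE \<omega> in M. \<bar>Z \<omega>\<bar> \<le> u" "expectation Z = 0" for l :: real and Z
  proof -
    interpret interval_bounded_random_variable M Z "- u" u
    proof
      show "AE \<omega> in M. Z \<omega> \<in> {- u..u}"
        using Z(1) by eventually_elim auto
    qed measurable
    have "l\<^sup>2 * (u - - u)\<^sup>2 / 8 = l\<^sup>2 * u\<^sup>2 / 2"
      by (simp add: power2_eq_square)
    then show ?thesis
      using Hoeffdings_lemma_nn_integral_0[OF l Z(2)] by metis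
  qed
  have "(\<integral>\<^sup>+\<omega>. ennreal (exp (l * Y \<omega>)) \<partial>M) \<le> ennreal (exp (l\<^sup>2 * u\<^sup>2 / 2))" for l :: real
  proof (cases l "0::real" rule: linorder_cases)
    case less
    then show ?thesis
      using pos[of "- l" "\<lambda>\<omega>. - Y \<omega>"] bnd mean by simp
  next
    case equal
    then show ?thesis by (simp add: emeasure_space_1)
  next
    case greater
    then show ?thesis using pos bnd mean by simp
  qed
  then show ?thesis by (simp add: subgaussian_def)
qed

text \<open>Condition on \<open>Y = y\<close>: integrating out \<open>X\<close> costs a factor
  \<open>exp (l\<^sup>2 (1 + b y)\<^sup>2 V / 2)\<close>, which is at most its value with \<open>|b| u\<close> in place of \<open>b y\<close>. This
  constant comes out of the integral over \<open>Y\<close>, and what is left is the moment generating function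
  of \<open>a Y\<close>. The product \<open>X Y\<close> is thus handled although it is not a sum of independent
  variables.\<close>

lemma subgaussian_perturb:
  assumes ind: "indep_var borel X borel Y"
    and X: "subgaussian M V X" and V: "V \<ge> 0"
    and bnd: "AE \<omega> in M. \<bar>Y \<omega>\<bar> \<le> u" and mean: "expectation Y = 0"
  shows "subgaussian M ((1 + \<bar>b\<bar> * u)\<^sup>2 * V + (a * u)\<^sup>2)
           (\<lambda>\<omega>. X \<omega> * (1 + b * Y \<omega>) + a * Y \<omega>)"
    (is "subgaussian M ?W ?Z")
proof -
  have [measurable]: "random_variable borel X" "random_variable borel Y"
    using ind by (auto dest: indep_var_rv1 indep_var_rv2)
  have prod: "distr M borel X \<Otimes>\<^sub>M distr M borel Y =
      distr M (borel \<Otimes>\<^sub>M borel) (\<lambda>\<omega>. (X \<omega>, Y \<omega>))"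
    using ind by (simp add: indep_var_distribution_eq)
  interpret X: prob_space "distr M borel X" by (rule prob_space_distr) measurable
  interpret Y: prob_space "distr M borel Y" by (rule prob_space_distr) measurable
  interpret XY: pair_sigma_finite "distr M borel X" "distr M borel Y" ..
  have Y_subgaussian: "subgaussian M (u\<^sup>2) Y"
    using bnd mean by (intro bounded_centered_subgaussian) auto
  have "(\<integral>\<^sup>+\<omega>. ennreal (exp (l * ?Z \<omega>)) \<partial>M) \<le> ennreal (exp (l\<^sup>2 * ?W / 2))" for l
  proof -
    let ?C = "l\<^sup>2 * ((1 + \<bar>b\<bar> * u)\<^sup>2 * V) / 2"
    let ?f = "\<lambda>p. ennreal (exp (l * (fst p * (1 + b * snd p) + a * snd p)))"
    have inner: "(\<integral>\<^sup>+\<omega>. ?f (X \<omega>, y) \<partial>M) \<le> ennreal (exp (?C + l * a * y))"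
      if y: "\<bar>y\<bar> \<le> u" for y
    proof -
      have "\<bar>1 + b * y\<bar> \<le> 1 + \<bar>b\<bar> * \<bar>y\<bar>"
        using abs_triangle_ineq[of 1 "b * y"] by (simp add: abs_mult)
      also have "\<dots> \<le> 1 + \<bar>b\<bar> * u"
        using y by (simp add: mult_left_mono)
      finally have "(1 + b * y)\<^sup>2 \<le> (1 + \<bar>b\<bar> * u)\<^sup>2"
        by (rule power2_le_iff_abs_le[THEN iffD2, rotated]) (use y in simp)
      then have le: "(l * (1 + b * y))\<^sup>2 * V / 2 \<le> ?C"
        unfolding power_mult_distrib mult.assoc
        by (intro divide_right_mono mult_left_mono mult_right_mono) (use V in auto)
      have "(\<integral>\<^sup>+\<omega>. ?f (X \<omega>, y) \<partial>M) =
          (\<integral>\<^sup>+\<omega>. ennreal (exp (l * (1 + b * y) * X \<omega>)) * ennreal (exp (l * a * y)) \<partial>M)"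
        by (intro nn_integral_cong)
           (simp add: algebra_simps flip: ennreal_mult exp_add)
      also have "\<dots> = (\<integral>\<^sup>+\<omega>. ennreal (exp (l * (1 + b * y) * X \<omega>)) \<partial>M) * ennreal (exp (l * a * y))"
        by (intro nn_integral_multc) measurable
      also have "\<dots> \<le> ennreal (exp ((l * (1 + b * y))\<^sup>2 * V / 2)) * ennreal (exp (l * a * y))"
        by (intro mult_right_mono subgaussian_nn_integral_le[OF X]) auto
      also have "\<dots> = ennreal (exp ((l * (1 + b * y))\<^sup>2 * V / 2 + l * a * y))"
        by (simp add: exp_add flip: ennreal_mult)
      also have "\<dots> \<le> ennreal (exp (?C + l * a * y))"
        using le by (intro ennreal_leI) simp
      finally show ?thesis .
    qed
    have "(\<integral>\<^sup>+\<omega>. ennreal (exp (l * ?Z \<omega>)) \<partial>M) =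
        (\<integral>\<^sup>+p. ?f p \<partial>(distr M borel X \<Otimes>\<^sub>M distr M borel Y))"
      unfolding prod by (subst nn_integral_distr) auto
    also have "\<dots> = (\<integral>\<^sup>+y. \<integral>\<^sup>+x. ?f (x, y) \<partial>distr M borel X \<partial>distr M borel Y)"
      by (rule XY.nn_integral_snd[symmetric]) measurable
    also have "\<dots> = (\<integral>\<^sup>+\<omega>'. \<integral>\<^sup>+\<omega>. ?f (X \<omega>, Y \<omega>') \<partial>M \<partial>M)"
      by (simp add: nn_integral_distr)
    also have "\<dots> \<le> (\<integral>\<^sup>+\<omega>'. ennreal (exp (?C + l * a * Y \<omega>')) \<partial>M)"
      by (intro nn_integral_mono_AE eventually_mono[OF bnd] inner)
    also have "\<dots> = ennreal (exp ?C) * (\<integral>\<^sup>+\<omega>'. ennreal (exp (l * a * Y \<omega>')) \<partial>M)"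
      by (simp add: exp_add ennreal_mult nn_integral_cmult)
    also have "\<dots> \<le> ennreal (exp ?C) * ennreal (exp ((l * a)\<^sup>2 * u\<^sup>2 / 2))"
      by (intro mult_left_mono subgaussian_nn_integral_le[OF Y_subgaussian]) auto
    also have "\<dots> = ennreal (exp (l\<^sup>2 * ?W / 2))"
      by (simp add: algebra_simps add_divide_distrib flip: ennreal_mult exp_add)
    finally show ?thesis .
  qed
  then show ?thesis by (simp add: subgaussian_def)
qed

text \<open>Chernoff's bound with the minimizer \<open>l = s / V\<close> of the exponent \<open>- l s + l\<^sup>2 V / 2\<close>.\<close>

lemma subgaussian_upper_tail:
  assumes X: "subgaussian M V X" and V: "V > 0" and s: "s > 0"
  shows "prob {\<omega> \<in> space M. X \<omega> \<ge> s} \<le> exp (- s\<^sup>2 / (2 * V))"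
proof -
  note [measurable] = subgaussian_measurable[OF X]
  define l where "l = s / V"
  have l: "l > 0" using V s by (simp add: l_def)
  have "emeasure M {\<omega> \<in> space M. X \<omega> \<ge> s} \<le>
      ennreal (exp (- l * s)) * (\<integral>\<^sup>+\<omega>. ennreal (exp (l * X \<omega>)) * indicator (space M) \<omega> \<partial>M)"
    by (rule Chernoff_ineq_nn_integral_ge[OF l]) auto
  also have "(\<integral>\<^sup>+\<omega>. ennreal (exp (l * X \<omega>)) * indicator (space M) \<omega> \<partial>M) =
      (\<integral>\<^sup>+\<omega>. ennreal (exp (l * X \<omega>)) \<partial>M)"
    by (intro nn_integral_cong) auto
  also have "ennreal (exp (- l * s)) * (\<integral>\<^sup>+\<omega>. ennreal (exp (l * X \<omega>)) \<partial>M) \<le>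
      ennreal (exp (- l * s)) * ennreal (exp (l\<^sup>2 * V / 2))"
    by (intro mult_left_mono subgaussian_nn_integral_le[OF X]) auto
  also have "\<dots> = ennreal (exp (- s\<^sup>2 / (2 * V)))"
  proof -
    have "- l * s + l\<^sup>2 * V / 2 = - s\<^sup>2 / (2 * V)"
      using V by (simp add: l_def field_simps power2_eq_square)
    then show ?thesis by (metis exp_add ennreal_mult exp_ge_zero)
  qed
  finally show ?thesis by (simp add: emeasure_eq_measure)
qed

text \<open>The threshold is the value of \<open>s\<close> that makes the bound \<open>exp (- s\<^sup>2 / (2 V))\<close> on each of the two
  tails equal to \<open>\<eta> / 2\<close>.\<close>

lemma subgaussian_concentration:
  assumes X: "subgaussian M V X" and V: "V > 0" and \<eta>: "0 < \<eta>" "\<eta> < 1"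
  shows "prob {\<omega> \<in> space M. \<bar>X \<omega>\<bar> \<le> sqrt V * sqrt (2 * ln (2 / \<eta>))} \<ge> 1 - \<eta>"
proof -
  note [measurable] = subgaussian_measurable[OF X]
  define s where "s = sqrt V * sqrt (2 * ln (2 / \<eta>))"
  have ln: "ln (2 / \<eta>) > 0" using \<eta> by simp
  have s: "s > 0" unfolding s_def using V ln by simp
  have "- s\<^sup>2 / (2 * V) = - ln (2 / \<eta>)"
    using V ln by (simp add: s_def power_mult_distrib)
  then have tail: "exp (- s\<^sup>2 / (2 * V)) = \<eta> / 2"
    using \<eta> by (simp add: exp_minus)
  have "1 - prob {\<omega> \<in> space M. \<bar>X \<omega>\<bar> \<le> s} = prob {\<omega> \<in> space M. \<not> \<bar>X \<omega>\<bar> \<le> s}"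
    by (rule prob_neg[symmetric]) measurable
  also have "\<dots> \<le> prob ({\<omega> \<in> space M. X \<omega> \<ge> s} \<union> {\<omega> \<in> space M. - X \<omega> \<ge> s})"
    by (intro finite_measure_mono) auto
  also have "\<dots> \<le> prob {\<omega> \<in> space M. X \<omega> \<ge> s} + prob {\<omega> \<in> space M. - X \<omega> \<ge> s}"
    by (rule measure_Un_le) measurable
  also have "\<dots> \<le> \<eta> / 2 + \<eta> / 2"
    using subgaussian_upper_tail[OF X V s] subgaussian_upper_tail[OF subgaussian_uminus[OF X] V s]
    unfolding tail by (rule add_mono)
  finally show ?thesis by (simp add: s_def)
qed

end


section \<open>Rounding errors of shifted summation\<close>

lemma shifted_partial_sum_closed_form:
  "k \<le> n \<Longrightarrow> shifted_partial_sum x c n k = (\<Sum>j = 1..k. x j) - real k * c"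
  by (induction k) (simp_all add: shifted_summand_def algebra_simps)

lemma shifted_partial_sum_final:
  "shifted_partial_sum x c n (n + 1) = (\<Sum>j = 1..n. x j)"
  by (simp add: shifted_partial_sum_closed_form shifted_summand_def)

text \<open>The centering error of the new summand and the error so far pass through the same rounded
  addition, while the exact part of the sum contributes \<open>t\<^bsub>k+1\<^esub> \<delta>\<^bsub>k+1\<^esub>\<close>. This splits one step into
  two perturbations by independent roundoffs.\<close>

lemma fl_shifted_partial_sum_error_Suc:
  fixes x :: "nat \<Rightarrow> real" and c :: real and n :: nat and \<epsilon> \<delta> :: "nat \<Rightarrow> real"
  defines "e \<equiv> (\<lambda>k. fl_shifted_partial_sum x c n \<epsilon> \<delta> k - shifted_partial_sum x c n k)"
  shows "e (Suc k) =
    (e k + shifted_summand x c n (Suc k) * \<epsilon> (Suc k)) * (1 + \<delta> (Suc k))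
      + shifted_partial_sum x c n (Suc k) * \<delta> (Suc k)"
  by (simp add: e_def algebra_simps)

lemma fl_shifted_partial_sum_cong:
  assumes "\<And>j. 1 \<le> j \<Longrightarrow> j \<le> k \<Longrightarrow> \<epsilon> j = \<epsilon>' j \<and> \<delta> j = \<delta>' j"
  shows "fl_shifted_partial_sum x c n \<epsilon> \<delta> k = fl_shifted_partial_sum x c n \<epsilon>' \<delta>' k"
  using assms by (induction k) simp_all

lemma fl_shifted_partial_sum_eq_0:
  assumes "\<And>j. 1 \<le> j \<Longrightarrow> j \<le> k \<Longrightarrow> shifted_summand x c n j = 0"
  shows "fl_shifted_partial_sum x c n \<epsilon> \<delta> k = 0"
  using assms by (induction k) simp_all

text \<open>All roundoffs form one family indexed by a disjoint sum, with centering errors on the left and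
  summation errors on the right. Seen as a function of this family, the computed partial sum is
  measurable already on the product over the indices up to \<open>k\<close>; independence of later roundoffs
  follows from this. There is no summation error with index \<open>1\<close>, so it is replaced by
  \<open>0\<close>.\<close>

lemma measurable_fl_shifted_partial_sum:
  fixes I :: "(nat + nat) set"
  assumes "Inl ` {1..k} \<subseteq> I" and "Inr ` {2..k} \<subseteq> I"
  shows "(\<lambda>w. fl_shifted_partial_sum x c n (\<lambda>j. w (Inl j)) ((\<lambda>j. w (Inr j))(1 := 0)) k)
           \<in> borel_measurable (PiM I (\<lambda>_. borel))"
  using assms
proof (induction k)
  case (Suc k)
  let ?N = "PiM I (\<lambda>_. borel :: real measure)"
  have IH: "(\<lambda>w. fl_shifted_partial_sum x c n (\<lambda>j. w (Inl j)) ((\<lambda>j. w (Inr j))(1 := 0)) k)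
      \<in> borel_measurable ?N"
    using Suc.prems by (intro Suc.IH) (auto simp: image_subset_iff)
  have \<epsilon>: "(\<lambda>w. w (Inl (Suc k))) \<in> borel_measurable ?N"
    using Suc.prems(1) by (intro measurable_component_singleton) auto
  have \<delta>: "(\<lambda>w. ((\<lambda>j. w (Inr j))(1 := 0)) (Suc k)) \<in> borel_measurable ?N"
  proof (cases "k = 0")
    case False
    then have "Inr (Suc k) \<in> I" using Suc.prems(2) by auto
    then show ?thesis using False by (simp add: measurable_component_singleton)
  qed simp
  show ?case unfolding fl_shifted_partial_sum.simps
    by (intro borel_measurable_times borel_measurable_add borel_measurable_const IH \<epsilon> \<delta>)
qed simp

lemma (in prob_space) indep_var_measurable_component:
  assumes ind: "indep_vars (\<lambda>_. borel) Z J"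
    and A: "A \<subseteq> J" "i \<in> J" "i \<notin> A"
    and f: "f \<in> borel_measurable (PiM A (\<lambda>_. borel))"
  shows "indep_var borel (\<lambda>\<omega>. f (restrict (\<lambda>j. Z j \<omega>) A)) borel (Z i)"
proof -
  have "indep_var borel (f \<circ> (\<lambda>\<omega>. restrict (\<lambda>j. Z j \<omega>) A))
      borel ((\<lambda>w. w i) \<circ> (\<lambda>\<omega>. restrict (\<lambda>j. Z j \<omega>) {i}))"
    using A f by (intro indep_var_compose[OF indep_var_restrict[OF ind]]) auto
  then show ?thesis by (simp add: comp_def)
qed

text \<open>The geometric sum is the solution of \<open>V\<^bsub>k+1\<^esub> = (1 + u)\<^sup>2 (V\<^sub>k + B\<^sup>2 u\<^sup>2)\<close> with
  \<open>V\<^sub>0 = 0\<close>. The induction starts at \<open>k = 1\<close> because the first step has a centering error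
  only.\<close>

lemma (in prob_space) fl_shifted_partial_sum_error_subgaussian:
  fixes \<epsilon> \<delta> :: "nat \<Rightarrow> 'a \<Rightarrow> real"
  assumes ind: "indep_vars (\<lambda>_. borel) (case_sum \<epsilon> \<delta>) ({1..m} <+> {2..m})"
    and \<epsilon>: "\<And>k. k \<in> {1..m} \<Longrightarrow> expectation (\<epsilon> k) = 0"
      "\<And>k. k \<in> {1..m} \<Longrightarrow> AE \<omega> in M. \<bar>\<epsilon> k \<omega>\<bar> \<le> u"
    and \<delta>: "\<And>k. k \<in> {2..m} \<Longrightarrow> expectation (\<delta> k) = 0"
      "\<And>k. k \<in> {2..m} \<Longrightarrow> AE \<omega> in M. \<bar>\<delta> k \<omega>\<bar> \<le> u"
    and u: "0 \<le> u"
    and B: "\<And>k. k \<in> {1..m} \<Longrightarrow> \<bar>shifted_partial_sum x c n k\<bar> + \<bar>shifted_summand x c n k\<bar> \<le> B"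
    and k: "1 \<le> k" "k \<le> m"
  shows "subgaussian M (B\<^sup>2 * u\<^sup>2 * (\<Sum>j = 1..k. (1 + u) ^ (2 * j)))
    (\<lambda>\<omega>. fl_shifted_partial_sum x c n (\<lambda>j. \<epsilon> j \<omega>) ((\<lambda>j. \<delta> j \<omega>)(1 := 0)) k
           - shifted_partial_sum x c n k)"
  using k
proof (induction k rule: nat_induct_at_least)
  case base
  let ?y = "shifted_summand x c n 1"
  have "indep_var borel (\<lambda>_. 0) borel (\<epsilon> 1)"
    using indep_var_measurable_component[OF ind, of "{}" "Inl 1" "\<lambda>_. 0"] base
    by (simp add: InlI)
  moreover have "subgaussian M 0 (\<lambda>_. 0)"
    by (simp add: subgaussian_def emeasure_space_1)
  ultimately have "subgaussian M ((?y * u)\<^sup>2) (\<lambda>\<omega>. ?y * \<epsilon> 1 \<omega>)"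
    using subgaussian_perturb[of "\<lambda>_. 0" "\<epsilon> 1" 0 u 0 ?y] \<epsilon>[of 1] base by simp
  moreover have "(?y * u)\<^sup>2 \<le> B\<^sup>2 * u\<^sup>2 * (\<Sum>j = 1..1. (1 + u) ^ (2 * j))"
  proof -
    have "?y\<^sup>2 \<le> B\<^sup>2"
      using B[of 1] base by (intro power2_le_iff_abs_le[THEN iffD2]) auto
    moreover have "1 \<le> (1 + u)\<^sup>2" using u by (simp add: one_le_power)
    ultimately have "?y\<^sup>2 * u\<^sup>2 * 1 \<le> B\<^sup>2 * u\<^sup>2 * (1 + u)\<^sup>2"
      by (intro mult_mono) auto
    then show ?thesis by (simp add: power_mult_distrib)
  qed
  ultimately have "subgaussian M (B\<^sup>2 * u\<^sup>2 * (\<Sum>j = 1..1. (1 + u) ^ (2 * j))) (\<lambda>\<omega>. ?y * \<epsilon> 1 \<omega>)"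
    by (rule subgaussian_mono)
  moreover have "(\<lambda>\<omega>. ?y * \<epsilon> 1 \<omega>) =
      (\<lambda>\<omega>. fl_shifted_partial_sum x c n (\<lambda>j. \<epsilon> j \<omega>) ((\<lambda>j. \<delta> j \<omega>)(1 := 0)) 1
           - shifted_partial_sum x c n 1)"
    by (simp add: fun_eq_iff algebra_simps)
  ultimately show ?case by simp
next
  case (Suc k)
  define Z where "Z = case_sum \<epsilon> \<delta>"
  define A :: "(nat + nat) set" where "A = Inl ` {1..k} \<union> Inr ` {2..k}"
  define F where "F = (\<lambda>w :: nat + nat \<Rightarrow> real.
    fl_shifted_partial_sum x c n (\<lambda>j. w (Inl j)) ((\<lambda>j. w (Inr j))(1 := 0)) k
      - shifted_partial_sum x c n k)"
  define e where "e = (\<lambda>k \<omega>. fl_shifted_partial_sum x c n (\<lambda>j. \<epsilon> j \<omega>) ((\<lambda>j. \<delta> j \<omega>)(1 := 0)) k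
           - shifted_partial_sum x c n k)"
  define y where "y = shifted_summand x c n (Suc k)"
  define t where "t = shifted_partial_sum x c n (Suc k)"
  define V where "V = B\<^sup>2 * u\<^sup>2 * (\<Sum>j = 1..k. (1 + u) ^ (2 * j))"
  define X where "X = (\<lambda>\<omega>. e k \<omega> + y * \<epsilon> (Suc k) \<omega>)"
  have IH: "subgaussian M V (e k)"
    using Suc.IH[OF Suc_leD[OF Suc.prems]] unfolding V_def e_def .
  have V: "V \<ge> 0" unfolding V_def using u by (intro mult_nonneg_nonneg sum_nonneg) auto
  have AJ: "A \<subseteq> {1..m} <+> {2..m}"
    using Suc.prems by (auto simp: A_def)
  have F_restrict: "F (restrict (\<lambda>j. Z j \<omega>) A') = e k \<omega>" if "A \<subseteq> A'" for \<omega> A'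
    unfolding F_def e_def using that
    by (intro arg_cong2[of _ _ _ _ "(-)"] fl_shifted_partial_sum_cong)
       (auto simp: A_def Z_def subset_iff)
  have F_measurable [measurable]: "F \<in> borel_measurable (PiM A' (\<lambda>_. borel))" if "A \<subseteq> A'" for A'
    unfolding F_def using that
    by (intro borel_measurable_diff measurable_fl_shifted_partial_sum) (auto simp: A_def)
  have "indep_var borel (\<lambda>\<omega>. F (restrict (\<lambda>j. Z j \<omega>) A)) borel (Z (Inl (Suc k)))"
    using AJ Suc.prems ind
    by (intro indep_var_measurable_component[of Z "{1..m} <+> {2..m}"] F_measurable)
       (auto simp: A_def Z_def)
  then have ind_\<epsilon>: "indep_var borel (e k) borel (\<epsilon> (Suc k))"
    by (simp add: F_restrict) (simp add: Z_def)
  have X: "subgaussian M (V + (y * u)\<^sup>2) X"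
    using subgaussian_perturb[OF ind_\<epsilon> IH V, of u 0 y] \<epsilon>[of "Suc k"] Suc.prems
    by (simp add: X_def)
  \<comment> \<open>\<open>X\<close> depends on the centering error of the current step as well, so the index set of the first
    block grows by one before the summation error is split off.\<close>
  let ?A = "insert (Inl (Suc k)) A"
  have "indep_var borel (\<lambda>\<omega>. (\<lambda>w. F w + y * w (Inl (Suc k))) (restrict (\<lambda>j. Z j \<omega>) ?A))
      borel (Z (Inr (Suc k)))"
    using AJ Suc ind
    by (intro indep_var_measurable_component[of Z "{1..m} <+> {2..m}"] borel_measurable_add
          borel_measurable_times F_measurable measurable_component_singleton)
       (auto simp: A_def Z_def)
  then have ind_\<delta>: "indep_var borel X borel (\<delta> (Suc k))"
    by (simp add: F_restrict subset_insertI X_def) (simp add: Z_def)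
  have step: "subgaussian M ((1 + u)\<^sup>2 * (V + (y * u)\<^sup>2) + (t * u)\<^sup>2)
      (\<lambda>\<omega>. X \<omega> * (1 + \<delta> (Suc k) \<omega>) + t * \<delta> (Suc k) \<omega>)"
    using subgaussian_perturb[OF ind_\<delta> X, of u 1 t] \<delta>[of "Suc k"] Suc V by simp
  have recursion: "(\<lambda>\<omega>. X \<omega> * (1 + \<delta> (Suc k) \<omega>) + t * \<delta> (Suc k) \<omega>) = e (Suc k)"
  proof
    fix \<omega>
    have "((\<lambda>j. \<delta> j \<omega>)(1 := 0)) (Suc k) = \<delta> (Suc k) \<omega>"
      using Suc.hyps by simp
    then show "X \<omega> * (1 + \<delta> (Suc k) \<omega>) + t * \<delta> (Suc k) \<omega> = e (Suc k) \<omega>"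
      unfolding e_def X_def y_def t_def fl_shifted_partial_sum_error_Suc by (simp only:)
  qed
  have proxy: "(1 + u)\<^sup>2 * (V + (y * u)\<^sup>2) + (t * u)\<^sup>2 \<le>
      B\<^sup>2 * u\<^sup>2 * (\<Sum>j = 1..Suc k. (1 + u) ^ (2 * j))"
  proof -
    have "t\<^sup>2 + y\<^sup>2 \<le> (\<bar>t\<bar> + \<bar>y\<bar>)\<^sup>2" by (simp add: power2_sum)
    also have "\<dots> \<le> B\<^sup>2"
      using B[of "Suc k"] Suc.prems by (intro power_mono) (auto simp: t_def y_def)
    finally have B2: "t\<^sup>2 + y\<^sup>2 \<le> B\<^sup>2" .
    have one: "1 \<le> (1 + u)\<^sup>2" using u by (simp add: one_le_power)
    have "(t * u)\<^sup>2 \<le> (1 + u)\<^sup>2 * (t * u)\<^sup>2"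
      using mult_right_mono[OF one, of "(t * u)\<^sup>2"] by simp
    then have "(1 + u)\<^sup>2 * (V + (y * u)\<^sup>2) + (t * u)\<^sup>2 \<le>
        (1 + u)\<^sup>2 * (V + (t\<^sup>2 + y\<^sup>2) * u\<^sup>2)"
      by (simp add: algebra_simps)
    also have "\<dots> \<le> (1 + u)\<^sup>2 * (V + B\<^sup>2 * u\<^sup>2)"
      using B2 by (intro mult_left_mono add_left_mono mult_right_mono) auto
    also have "\<dots> = B\<^sup>2 * u\<^sup>2 * ((1 + u)\<^sup>2 + (1 + u)\<^sup>2 * (\<Sum>j = 1..k. (1 + u) ^ (2 * j)))"
      by (simp add: V_def algebra_simps)
    also have "(1 + u)\<^sup>2 + (1 + u)\<^sup>2 * (\<Sum>j = 1..k. (1 + u) ^ (2 * j)) =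
        (\<Sum>j = 1..Suc k. (1 + u) ^ (2 * j))"
    proof -
      have "q + q * (\<Sum>j = 1..k. q ^ j) = (\<Sum>j = 1..Suc k. q ^ j)" for q :: real
        by (induction k) (simp_all add: distrib_left)
      then show ?thesis unfolding power_mult .
    qed
    finally show ?thesis .
  qed
  show ?case
    using subgaussian_mono[OF step proxy] unfolding recursion e_def .
qed

section \<open>The growth factor\<close>

text \<open>Adding the term \<open>j = 0\<close> makes the sum a full geometric series with ratio
  \<open>q = (1 + u)\<^sup>2\<close>. One factor \<open>u\<close> is absorbed by \<open>2 u \<le> q - 1\<close>, and
  \<open>q - 1\<close> times the series telescopes.\<close>

lemma geometric_sum_le_roundoff_gamma:
  assumes "0 \<le> u"
  shows "u\<^sup>2 * (\<Sum>j = 1..m. (1 + u) ^ (2 * j)) \<le> u * roundoff_gamma u (2 * (m + 1)) / 2"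
proof -
  let ?q = "(1 + u)\<^sup>2"
  have "(\<Sum>j = 1..m. (1 + u) ^ (2 * j)) \<le> (\<Sum>j<m + 1. ?q ^ j)"
    unfolding power_mult by (rule sum_mono2) (use assms in auto)
  then have "u * (2 * u) * (\<Sum>j = 1..m. (1 + u) ^ (2 * j)) \<le> u * (?q - 1) * (\<Sum>j<m + 1. ?q ^ j)"
    using assms
    by (intro mult_mono) (auto intro!: sum_nonneg mult_nonneg_nonneg simp: power2_eq_square algebra_simps)
  also have "\<dots> = u * roundoff_gamma u (2 * (m + 1))"
    unfolding roundoff_gamma_def power_mult power_diff_1_eq[of ?q "m + 1"] by simp
  finally show ?thesis by (simp add: power2_eq_square)
qed

text \<open>Since \<open>(1 + u) (1 - u) \<le> 1\<close>, Bernoulli's inequality \<open>1 - k u \<le> (1 - u)\<^sup>k\<close> gives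
  \<open>(1 + u)\<^sup>k (1 - k u) \<le> 1\<close>.\<close>

lemma roundoff_gamma_le:
  assumes u: "0 \<le> u" and k: "real k * u < 1"
  shows "roundoff_gamma u k \<le> real k * u / (1 - real k * u)"
proof (cases "k = 0")
  case False
  then have "u \<le> real k * u" using u by (simp add: mult_le_cancel_right1)
  then have "u < 1" using k by linarith
  have "(1 + u) ^ k * (1 - real k * u) \<le> (1 + u) ^ k * (1 - u) ^ k"
    using Bernoulli_inequality[of "- u" k] \<open>u < 1\<close> u by (intro mult_left_mono) auto
  also have "\<dots> = (1 - u\<^sup>2) ^ k"
    by (simp add: algebra_simps power2_eq_square flip: power_mult_distrib)
  also have "\<dots> \<le> 1"
    using u \<open>u < 1\<close> by (intro power_le_one) (auto simp: power_le_one)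
  finally show ?thesis
    using k by (simp add: roundoff_gamma_def field_simps)
qed (simp add: roundoff_gamma_def)

lemma sqrt_roundoff_gamma_le:
  assumes "0 \<le> u" and "2 * real m * u < 1"
  shows "sqrt (u * roundoff_gamma u (2 * m) / 2) \<le> sqrt (real m * u\<^sup>2 / (1 - 2 * real m * u))"
proof -
  have "u * roundoff_gamma u (2 * m) / 2 \<le> u * (2 * real m * u / (1 - 2 * real m * u)) / 2"
    using roundoff_gamma_le[of u "2 * m"] assms by (intro divide_right_mono mult_left_mono) auto
  also have "\<dots> = real m * u\<^sup>2 / (1 - 2 * real m * u)"
    using assms(2) by (simp add: field_simps power2_eq_square)
  finally show ?thesis by simp
qed

text \<open>With \<open>w = (m + 2) v > 0\<close> the ratio equals \<open>sqrt (1 / (1 - 2 w))\<close>, so it depends on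
  \<open>(m, v)\<close> only through the quantity along which the filter is pulled back.\<close>

lemma growth_factor_ratio_tendsto_1:
  "((\<lambda>(m::nat, v::real).
      sqrt (real (m + 2) * v\<^sup>2 / (1 - 2 * real (m + 2) * v)) / (sqrt (real (m + 2)) * v))
    \<longlongrightarrow> 1) (filtercomap (\<lambda>(m, v). real (m + 2) * v) (at_right 0))"
    (is "(?f \<longlongrightarrow> 1) (filtercomap ?w _)")
proof -
  have "((\<lambda>w :: real. sqrt (1 / (1 - 2 * w))) \<longlongrightarrow> sqrt (1 / (1 - 2 * 0))) (at_right 0)"
    by (intro tendsto_intros) auto
  then have "((\<lambda>p. sqrt (1 / (1 - 2 * ?w p))) \<longlongrightarrow> 1) (filtercomap ?w (at_right 0))"
    by (intro filterlim_compose[OF _ filterlim_filtercomap]) simp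
  moreover have "\<forall>\<^sub>F p in filtercomap ?w (at_right 0). sqrt (1 / (1 - 2 * ?w p)) = ?f p"
    unfolding eventually_filtercomap
  proof (intro exI conjI allI impI)
    show "\<forall>\<^sub>F w in at_right (0 :: real). w > 0"
      by (rule eventually_at_right_less)
  next
    fix p :: "nat \<times> real" assume w: "?w p > 0"
    obtain m v where p: "p = (m, v)" by (cases p)
    have v: "v > 0" using w by (simp add: p zero_less_mult_iff)
    have "sqrt (real (m + 2) * v\<^sup>2 / (1 - 2 * real (m + 2) * v)) =
        sqrt (real (m + 2)) * v * sqrt (1 / (1 - 2 * (real (m + 2) * v)))"
      using v by (simp add: real_sqrt_mult real_sqrt_divide mult.assoc)
    then show "sqrt (1 / (1 - 2 * ?w p)) = ?f p"
      using v by (simp add: p)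
  qed
  ultimately show ?thesis by (rule Lim_transform_eventually)
qed

section \<open>The probabilistic error bound\<close>

theorem theorem3p2:
  fixes M :: "'a measure"
    and n :: nat and x :: "nat \<Rightarrow> real" and c u \<eta> :: real
    and \<epsilon> \<delta> :: "nat \<Rightarrow> 'a \<Rightarrow> real"
  assumes "prob_space M"
    and "n \<ge> 1"
    and "0 < u" and "u < 1"
    and "0 < \<eta>" and "\<eta> < 1"
    and "\<And>\<omega>. \<omega> \<in> space M \<Longrightarrow> \<delta> 1 \<omega> = 0"
    and "prob_space.indep_vars M (\<lambda>_. borel) (case_sum \<epsilon> \<delta>) ({1..n+1} <+> {2..n+1})"
    and "\<And>k. k \<in> {1..n+1} \<Longrightarrow> prob_space.expectation M (\<epsilon> k) = 0"
    and "\<And>k. k \<in> {2..n+1} \<Longrightarrow> prob_space.expectation M (\<delta> k) = 0"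
    and "\<And>k. k \<in> {1..n+1} \<Longrightarrow> AE \<omega> in M. \<bar>\<epsilon> k \<omega>\<bar> \<le> u"
    and "\<And>k. k \<in> {2..n+1} \<Longrightarrow> AE \<omega> in M. \<bar>\<delta> k \<omega>\<bar> \<le> u"
  defines "s \<equiv> (\<lambda>k. \<Sum>j = 1..k. x j)"
    and "y \<equiv> shifted_summand x c n"
    and "t \<equiv> shifted_partial_sum x c n"
  shows "measure M {\<omega> \<in> space M.
            \<bar>fl_shifted_sum x c n (\<lambda>k. \<epsilon> k \<omega>) (\<lambda>k. \<delta> k \<omega>) - s n\<bar>
              \<le> (MAX k\<in>{1..n+1}. \<bar>t k\<bar> + \<bar>y k\<bar>)
                  * sqrt (u * roundoff_gamma u (2 * (n + 2)) / 2) * sqrt (2 * ln (2 / \<eta>))}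
          \<ge> 1 - \<eta>
      \<and> (\<forall>k\<in>{1..n}. t k = s k - real k * c \<and> y k = x k - c)
      \<and> t (n + 1) = s n \<and> y (n + 1) = real n * c
      \<and> (2 * real (n + 2) * u < 1 \<longrightarrow>
          sqrt (u * roundoff_gamma u (2 * (n + 2)) / 2)
            \<le> sqrt (real (n + 2) * u\<^sup>2 / (1 - 2 * real (n + 2) * u)))
      \<and> ((\<lambda>(m::nat, v::real).
              sqrt (real (m + 2) * v\<^sup>2 / (1 - 2 * real (m + 2) * v)) / (sqrt (real (m + 2)) * v))
            \<longlongrightarrow> 1) (filtercomap (\<lambda>(m, v). real (m + 2) * v) (at_right 0))"
proof -
  interpret prob_space M by fact
  note u = \<open>0 < u\<close> and \<eta> = \<open>0 < \<eta>\<close> \<open>\<eta> < 1\<close>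
  define B where "B = (MAX k\<in>{1..n+1}. \<bar>t k\<bar> + \<bar>y k\<bar>)"
  define G where "G = u * roundoff_gamma u (2 * (n + 2)) / 2"
  define E where "E = (\<lambda>\<omega>. fl_shifted_partial_sum x c n (\<lambda>j. \<epsilon> j \<omega>) ((\<lambda>j. \<delta> j \<omega>)(1 := 0)) (n + 1)
           - shifted_partial_sum x c n (n + 1))"
  have le_B: "\<bar>t k\<bar> + \<bar>y k\<bar> \<le> B" if "k \<in> {1..n+1}" for k
    unfolding B_def using that by (intro Max_ge) auto
  have E_eq: "fl_shifted_sum x c n (\<lambda>k. \<epsilon> k \<omega>) (\<lambda>k. \<delta> k \<omega>) - s n = E \<omega>" if "\<omega> \<in> space M" for \<omega>
  proof -
    have "(\<lambda>j. \<delta> j \<omega>)(1 := 0) = (\<lambda>k. \<delta> k \<omega>)"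
      using assms(7)[OF that] by (simp add: fun_eq_iff)
    then show ?thesis
      unfolding E_def shifted_partial_sum_final by (simp only: fl_shifted_sum_def s_def)
  qed
  have "1 < (1 + u) ^ (2 * (n + 2))"
    using u by (intro one_less_power) auto
  then have G: "G > 0"
    using u by (simp add: G_def roundoff_gamma_def)
  have "prob {\<omega> \<in> space M. \<bar>E \<omega>\<bar> \<le> B * sqrt G * sqrt (2 * ln (2 / \<eta>))} \<ge> 1 - \<eta>"
    \<comment> \<open>If \<open>B = 0\<close>, all summands vanish and there is no error; the Chernoff bound needs a positive
      variance proxy.\<close>
  proof (cases "B = 0")
    case True
    then have zero: "y k = 0" "t k = 0" if "k \<in> {1..n+1}" for k
      using le_B[OF that] by auto
    have "E \<omega> = 0" for \<omega>
    proof -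
      have "fl_shifted_partial_sum x c n (\<lambda>j. \<epsilon> j \<omega>) ((\<lambda>j. \<delta> j \<omega>)(1 := 0)) (n + 1) = 0"
        using zero(1) by (intro fl_shifted_partial_sum_eq_0) (simp add: y_def)
      moreover have "shifted_partial_sum x c n (n + 1) = 0"
        using zero(2)[of "n + 1"] unfolding t_def by simp
      ultimately show ?thesis unfolding E_def by (simp only: diff_self)
    qed
    then show ?thesis using True \<eta> by (simp add: prob_space)
  next
    case False
    moreover have "0 \<le> \<bar>t 1\<bar> + \<bar>y 1\<bar>" "\<bar>t 1\<bar> + \<bar>y 1\<bar> \<le> B"
      using le_B[of 1] by simp_all
    ultimately have "B > 0" by linarith
    have "subgaussian M (B\<^sup>2 * u\<^sup>2 * (\<Sum>j = 1..n+1. (1 + u) ^ (2 * j))) E"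
      unfolding E_def
    proof (rule fl_shifted_partial_sum_error_subgaussian[OF assms(8,9,11,10,12)])
      show "\<bar>shifted_partial_sum x c n k\<bar> + \<bar>shifted_summand x c n k\<bar> \<le> B" if "k \<in> {1..n+1}" for k
        using le_B[OF that] by (simp only: t_def y_def)
    qed (use u in simp_all)
    moreover have "B\<^sup>2 * u\<^sup>2 * (\<Sum>j = 1..n+1. (1 + u) ^ (2 * j)) \<le> B\<^sup>2 * G"
      using geometric_sum_le_roundoff_gamma[of u "n + 1"] u
      by (simp add: G_def mult.assoc mult_left_mono)
    ultimately have "subgaussian M (B\<^sup>2 * G) E"
      by (rule subgaussian_mono)
    moreover have "sqrt (B\<^sup>2 * G) = B * sqrt G"
      using \<open>B > 0\<close> by (simp add: real_sqrt_mult)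
    ultimately show ?thesis
      using subgaussian_concentration[of "B\<^sup>2 * G" E \<eta>] \<open>B > 0\<close> G \<eta> by simp
  qed
  also have "{\<omega> \<in> space M. \<bar>E \<omega>\<bar> \<le> B * sqrt G * sqrt (2 * ln (2 / \<eta>))} =
      {\<omega> \<in> space M. \<bar>fl_shifted_sum x c n (\<lambda>k. \<epsilon> k \<omega>) (\<lambda>k. \<delta> k \<omega>) - s n\<bar>
         \<le> B * sqrt G * sqrt (2 * ln (2 / \<eta>))}"
    using E_eq by auto
  finally have bound: "prob {\<omega> \<in> space M.
      \<bar>fl_shifted_sum x c n (\<lambda>k. \<epsilon> k \<omega>) (\<lambda>k. \<delta> k \<omega>) - s n\<bar>
         \<le> B * sqrt G * sqrt (2 * ln (2 / \<eta>))} \<ge> 1 - \<eta>" .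
  have "\<forall>k\<in>{1..n}. t k = s k - real k * c \<and> y k = x k - c"
    by (simp add: t_def s_def y_def shifted_partial_sum_closed_form shifted_summand_def)
  moreover have "t (n + 1) = s n"
    unfolding t_def s_def by (rule shifted_partial_sum_final)
  moreover have "y (n + 1) = real n * c"
    by (simp add: y_def shifted_summand_def)
  moreover have "2 * real (n + 2) * u < 1 \<longrightarrow>
      sqrt (u * roundoff_gamma u (2 * (n + 2)) / 2)
        \<le> sqrt (real (n + 2) * u\<^sup>2 / (1 - 2 * real (n + 2) * u))"
    by (intro impI sqrt_roundoff_gamma_le less_imp_le u)
  ultimately show ?thesis
    using bound[unfolded B_def G_def] growth_factor_ratio_tendsto_1 by (intro conjI)
qed

end
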